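(* Let $\tau\in\mathfrak M_{1,c}(\mathcal P)$. Then the following (1), (2), (3) are equivalent: (1) $T_{\infty,\tau}\equiv1$ on $\hat{\mathbb C}$; (2) $T_{\infty,\tau}|_{J(G_\tau)}\equiv1$; (3) $\hat K(G_\tau)=\emptyset$.
   Context: $\hat{\mathbb C}$ is the Riemann sphere with spherical distance $d$. $\mathcal P$ is the set of polynomial maps $\hat{\mathbb C}\to\hat{\mathbb C}$ of degree at least $2$, with the metric $\kappa(f,g)=\sup_zd(f(z),g(z))$. $\mathfrak M_{1,c}(\mathcal P)$ is the set of Borel probability measures on $\mathcal P$ with compact topological support. $G_\tau$ is the semigroup generated under composition by $\operatorname{supp}\tau$, and $\tilde\tau=\otimes_{j=1}^\infty\tau$. For a semigroup $G$ of polynomials, $F(G)$ is the set of $z\in\hat{\mathbb C}$ having a neighborhood on which $G$ is equicontinuous with respect to $d$, $J(G)=\hat{\mathbb C}\setminus F(G)$, and $\hat K(G)=\{z\in\mathbb C:\{g(z):g\in G\}\text{ is bounded in }\mathbb C\}$. $T_{\infty,\tau}(z)=\tilde\tau(\{\gamma=(\gamma_1,\gamma_2,\dots):\ \gamma_n\circ\cdots\circ\gamma_1(z)\to\infty\text{ as }n\to\infty\})$. *)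

theory Defs
  imports "HOL-Probability.Probability" "HOL-Computational_Algebra.Polynomial"
begin

section \<open>The Riemann sphere with the spherical distance\<close>

datatype csphere = Fin complex | Infty

text \<open>Inverse stereographic projection onto the unit sphere of \<open>\<complex> \<times> \<real>\<close> (that is, of three-dimensional
  Euclidean space), sending \<open>Infty\<close> to the north pole.\<close>

fun stereo :: "csphere \<Rightarrow> complex \<times> real" where
  "stereo (Fin z) = ((2 / (1 + (cmod z)\<^sup>2)) *\<^sub>R z, ((cmod z)\<^sup>2 - 1) / ((cmod z)\<^sup>2 + 1))"
| "stereo Infty = (0, 1)"

lemma norm_stereo: "norm (stereo z) = 1"
proof (cases z)
  case (Fin w)
  define s where "s = (cmod w)\<^sup>2"
  have s: "s \<ge> 0" by (simp add: s_def)
  have "(norm ((2 / (1 + s)) *\<^sub>R w))\<^sup>2 + ((s - 1) / (s + 1))\<^sup>2 = (4 * s + (s - 1)\<^sup>2) / (s + 1)\<^sup>2"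
    by (simp add: power_mult_distrib power_divide s_def[symmetric] add_divide_distrib add.commute)
  also have "\<dots> = 1"
  proof -
    have "4 * s + (s - 1)\<^sup>2 = (s + 1)\<^sup>2" by (simp add: power2_eq_square algebra_simps)
    moreover have "(s + 1)\<^sup>2 \<noteq> 0" using s by simp
    ultimately show ?thesis by simp
  qed
  finally show ?thesis using Fin by (simp add: norm_Pair s_def add.commute power_divide)
qed (simp add: norm_Pair)

lemma inj_stereo: "inj stereo"
proof (rule injI)
  fix x y assume eq: "stereo x = stereo y"
  have lt: "((cmod w)\<^sup>2 - 1) / ((cmod w)\<^sup>2 + 1) \<noteq> 1" for w
  proof -
    have "(cmod w)\<^sup>2 + 1 > 0" by (simp add: add_nonneg_pos)
    then show ?thesis by (simp add: divide_eq_eq)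
  qed
  show "x = y"
  proof (cases x; cases y)
    fix v w assume *: "x = Fin v" "y = Fin w"
    have p: "(cmod v)\<^sup>2 + 1 > 0" "(cmod w)\<^sup>2 + 1 > 0" by (simp_all add: add_nonneg_pos)
    have "((cmod v)\<^sup>2 - 1) / ((cmod v)\<^sup>2 + 1) = ((cmod w)\<^sup>2 - 1) / ((cmod w)\<^sup>2 + 1)"
      using eq * by simp
    then have "((cmod v)\<^sup>2 - 1) * ((cmod w)\<^sup>2 + 1) = ((cmod w)\<^sup>2 - 1) * ((cmod v)\<^sup>2 + 1)"
      using p by (simp add: frac_eq_eq)
    then have "(cmod v)\<^sup>2 = (cmod w)\<^sup>2" by (simp add: algebra_simps)
    moreover have "(2 / (1 + (cmod v)\<^sup>2)) *\<^sub>R v = (2 / (1 + (cmod w)\<^sup>2)) *\<^sub>R w"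
      using eq * by simp
    moreover have "2 / (1 + (cmod w)\<^sup>2) \<noteq> 0" using p by (simp add: add.commute)
    ultimately have "v = w" by (metis scaleR_left_imp_eq)
    with * show ?thesis by simp
  qed (use eq lt in \<open>auto dest: sym\<close>)
qed

lemma abs_inner_unit:
  fixes a b :: "'a::real_inner"
  assumes "norm a = 1" "norm b = 1"
  shows "\<bar>a \<bullet> b\<bar> \<le> 1"
  using Cauchy_Schwarz_ineq2[of a b] assms by simp

lemma angle_triangle:
  fixes a b c :: "'a::real_inner"
  assumes a: "norm a = 1" and b: "norm b = 1" and c: "norm c = 1"
  shows "arccos (a \<bullet> c) \<le> arccos (a \<bullet> b) + arccos (b \<bullet> c)"
proof -
  have bounds: "\<bar>a \<bullet> b\<bar> \<le> 1" "\<bar>b \<bullet> c\<bar> \<le> 1" "\<bar>a \<bullet> c\<bar> \<le> 1"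
    using abs_inner_unit a b c by blast+
  define p q where "p = a \<bullet> b" and "q = b \<bullet> c"
  define u v where "u = a - p *\<^sub>R b" and "v = c - q *\<^sub>R b"
  have aa: "a \<bullet> a = 1" and bb: "b \<bullet> b = 1" and cc: "c \<bullet> c = 1"
    using a b c by (simp_all add: dot_square_norm)
  have "u \<bullet> u = 1 - p\<^sup>2"
    by (simp add: u_def p_def inner_diff aa bb inner_commute[of b a] power2_eq_square algebra_simps)
  then have nu: "norm u = sqrt (1 - p\<^sup>2)" by (simp add: norm_eq_sqrt_inner)
  have "v \<bullet> v = 1 - q\<^sup>2"
    by (simp add: v_def q_def inner_diff cc bb inner_commute[of c b] power2_eq_square algebra_simps)
  then have nv: "norm v = sqrt (1 - q\<^sup>2)" by (simp add: norm_eq_sqrt_inner)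
  have uv: "u \<bullet> v = a \<bullet> c - p * q"
    by (simp add: u_def v_def p_def q_def inner_diff bb algebra_simps)
  have "- (norm u * norm v) \<le> u \<bullet> v"
    using Cauchy_Schwarz_ineq2[of u v] by linarith
  then have "p * q - sqrt (1 - p\<^sup>2) * sqrt (1 - q\<^sup>2) \<le> a \<bullet> c"
    using uv nu nv by simp
  moreover have "cos (arccos p + arccos q) = p * q - sqrt (1 - p\<^sup>2) * sqrt (1 - q\<^sup>2)"
    using bounds by (simp add: cos_add p_def q_def cos_arccos_abs sin_arccos_abs)
  ultimately have le: "cos (arccos p + arccos q) \<le> a \<bullet> c" by simp
  show ?thesis
  proof (cases "arccos p + arccos q \<le> pi")
    case True
    have "arccos (a \<bullet> c) \<le> arccos (cos (arccos p + arccos q))"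
      using le bounds by (intro arccos_le_arccos) auto
    also have "\<dots> = arccos p + arccos q"
      using True bounds arccos_lbound[of p] arccos_lbound[of q]
      by (intro arccos_cos) (auto simp: p_def q_def abs_le_iff)
    finally show ?thesis by (simp add: p_def q_def)
  next
    case False
    have "arccos (a \<bullet> c) \<le> pi" using bounds by (intro arccos_ubound) auto
    with False show ?thesis by (simp add: p_def q_def)
  qed
qed

text \<open>The distance is the geodesic (great-circle) distance on the unit sphere, i.e. the distance
  of the Riemannian metric \<open>2 |dz| / (1 + |z|\<^sup>2)\<close>.\<close>

instantiation csphere :: metric_space
begin

definition dist_csphere :: "csphere \<Rightarrow> csphere \<Rightarrow> real" where
  "dist_csphere z w = arccos (stereo z \<bullet> stereo w)"

definition uniformity_csphere :: "(csphere \<times> csphere) filter" where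
  "uniformity_csphere = (INF e\<in>{0<..}. principal {(x, y). dist x y < e})"

definition open_csphere :: "csphere set \<Rightarrow> bool" where
  "open_csphere U = (\<forall>x\<in>U. \<forall>\<^sub>F (x', y) in uniformity. x' = x \<longrightarrow> y \<in> U)"

instance
proof
  fix x y z :: csphere
  have *: "stereo x \<bullet> stereo x = 1" "stereo y \<bullet> stereo y = 1"
    by (simp_all add: dot_square_norm norm_stereo)
  have b: "\<bar>stereo x \<bullet> stereo y\<bar> \<le> 1" by (simp add: abs_inner_unit norm_stereo)
  show "dist x y = 0 \<longleftrightarrow> x = y"
  proof
    assume "dist x y = 0"
    then have "stereo x \<bullet> stereo y = 1"
      using b cos_arccos_abs[OF b] by (simp add: dist_csphere_def)
    then have "(stereo x - stereo y) \<bullet> (stereo x - stereo y) = 0"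
      using * by (simp add: inner_diff inner_commute)
    then show "x = y" using inj_stereo by (simp add: inj_eq)
  qed (simp add: dist_csphere_def *)
  show "dist x y \<le> dist x z + dist y z"
    using angle_triangle[of "stereo x" "stereo z" "stereo y"]
    by (simp add: dist_csphere_def norm_stereo inner_commute)
qed (simp_all add: uniformity_csphere_def open_csphere_def)

end

lemma dist_csphere_le_pi: "dist (z::csphere) w \<le> pi"
  unfolding dist_csphere_def
  using abs_inner_unit[OF norm_stereo[of z] norm_stereo[of w]] by (intro arccos_ubound) auto


section \<open>Polynomial maps of degree at least 2\<close>

fun sphere_poly :: "complex poly \<Rightarrow> csphere \<Rightarrow> csphere" where
  "sphere_poly p (Fin z) = Fin (poly p z)"
| "sphere_poly p Infty = Infty"

typedef polymap = "{sphere_poly p | p. degree p \<ge> 2}"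
  morphisms app Abs_polymap
  by (rule exI[of _ "sphere_poly (monom 1 2)"]) (auto simp: degree_monom_eq)

instantiation polymap :: metric_space
begin

definition dist_polymap :: "polymap \<Rightarrow> polymap \<Rightarrow> real" where
  "dist_polymap f g = (SUP z. dist (app f z) (app g z))"

definition uniformity_polymap :: "(polymap \<times> polymap) filter" where
  "uniformity_polymap = (INF e\<in>{0<..}. principal {(x, y). dist x y < e})"

definition open_polymap :: "polymap set \<Rightarrow> bool" where
  "open_polymap U = (\<forall>x\<in>U. \<forall>\<^sub>F (x', y) in uniformity. x' = x \<longrightarrow> y \<in> U)"

instance
proof
  fix f g h :: polymap
  have bdd: "bdd_above (range (\<lambda>z. dist (app f z) (app g z)))" for f g
    by (rule bdd_aboveI[where M = pi]) (auto simp: dist_csphere_le_pi)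
  have le: "dist (app f z) (app g z) \<le> dist f g" for f g z
    unfolding dist_polymap_def by (rule cSUP_upper[OF _ bdd]) simp
  show "dist f g = 0 \<longleftrightarrow> f = g"
  proof
    assume "dist f g = 0"
    then have "app f z = app g z" for z
      using le[of f z g] by simp
    then show "f = g" by (simp add: app_inject[symmetric] fun_eq_iff)
  qed (simp add: dist_polymap_def)
  show "dist f g \<le> dist f h + dist g h"
    unfolding dist_polymap_def[of f g]
  proof (rule cSUP_least)
    fix z
    show "dist (app f z) (app g z) \<le> dist f h + dist g h"
      using dist_triangle2[of "app f z" "app g z" "app h z"] le[of f z h] le[of g z h] by linarith
  qed simp
qed (simp_all add: uniformity_polymap_def open_polymap_def)

end


section \<open>Compactly supported measures, semigroups, Fatou and Julia sets\<close>

definition supp :: "'a::topological_space measure \<Rightarrow> 'a set" where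
  "supp M = {x. \<forall>U. open U \<and> x \<in> U \<longrightarrow> emeasure M U > 0}"

definition M1c :: "polymap measure set" where
  "M1c = {\<tau>. sets \<tau> = sets borel \<and> prob_space \<tau> \<and> compact (supp \<tau>)}"

inductive_set generated_semigroup :: "('a \<Rightarrow> 'a) set \<Rightarrow> ('a \<Rightarrow> 'a) set" for S where
  gen: "g \<in> S \<Longrightarrow> g \<in> generated_semigroup S"
| comp: "g \<in> generated_semigroup S \<Longrightarrow> h \<in> generated_semigroup S \<Longrightarrow>
    g \<circ> h \<in> generated_semigroup S"

definition semigroup_of :: "polymap measure \<Rightarrow> (csphere \<Rightarrow> csphere) set" where
  "semigroup_of \<tau> = generated_semigroup (app ` supp \<tau>)"

definition equicontinuous_on ::
    "'a::metric_space set \<Rightarrow> ('a \<Rightarrow> 'b::metric_space) set \<Rightarrow> bool" where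
  "equicontinuous_on U H \<longleftrightarrow>
    (\<forall>x\<in>U. \<forall>e>0. \<exists>d>0. \<forall>y\<in>U. dist x y < d \<longrightarrow> (\<forall>g\<in>H. dist (g x) (g y) < e))"

definition Fatou :: "(csphere \<Rightarrow> csphere) set \<Rightarrow> csphere set" where
  "Fatou H = {z. \<exists>U. open U \<and> z \<in> U \<and> equicontinuous_on U H}"

definition Julia :: "(csphere \<Rightarrow> csphere) set \<Rightarrow> csphere set" where
  "Julia H = - Fatou H"

text \<open>An orbit is bounded in \<open>\<complex>\<close> if it avoids \<open>Infty\<close> and is bounded for the Euclidean metric of
  \<open>\<complex>\<close>; the spherical metric is bounded, so \<open>bounded\<close> on \<open>csphere\<close> would be vacuous.\<close>

definition Khat :: "(csphere \<Rightarrow> csphere) set \<Rightarrow> complex set" where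
  "Khat H = {z. \<exists>B::complex set. bounded B \<and> (\<lambda>g. g (Fin z)) ` H \<subseteq> Fin ` B}"


section \<open>The probability of escaping to infinity\<close>

text \<open>Sequences are indexed from \<open>0\<close>, so \<open>random_iterate \<gamma> n\<close> is the composition
  of \<open>\<gamma> (n - 1), \<dots>, \<gamma> 0\<close>, with \<open>\<gamma> 0\<close> applied first.\<close>

primrec random_iterate :: "(nat \<Rightarrow> polymap) \<Rightarrow> nat \<Rightarrow> csphere \<Rightarrow> csphere" where
  "random_iterate \<gamma> 0 = id"
| "random_iterate \<gamma> (Suc n) = app (\<gamma> n) \<circ> random_iterate \<gamma> n"

definition T_inf :: "polymap measure \<Rightarrow> csphere \<Rightarrow> real" where
  "T_inf \<tau> z = measure (PiM UNIV (\<lambda>_::nat. \<tau>))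
    {\<gamma>. (\<lambda>n. random_iterate \<gamma> n z) \<longlonglongrightarrow> Infty}"

end

theory Submission
  imports Defs "HOL-Real_Asymp.Real_Asymp" "HOL-Computational_Algebra.Fundamental_Theorem_Algebra"
begin

text \<open>By compactness of the support there is a closed disc \<open>D\<close> outside of which every orbit along the
  support escapes to infinity, and \<open>Khat\<close> is the set of points whose semigroup orbit stays in \<open>D\<close>.
  If \<open>Khat\<close> is nonempty, its frontier lies in the Julia set and consists of points that escape with
  probability 0. Conversely, let \<open>u z\<close> be the probability that the random orbit of \<open>z\<close> never leaves
  \<open>D\<close>. This function is upper semicontinuous and satisfies a mean value equation, so if it is not
  identically zero then the whole semigroup orbit of a maximum point stays in \<open>D\<close>. Hence if \<open>Khat\<close>
  is empty then almost every orbit leaves \<open>D\<close> and escapes.\<close>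

section \<open>Countable bases from dense sets\<close>

text \<open>Reduces second countability to finding a countable dense set. It is used for the sphere
  and for \<open>polymap\<close>, where second countability makes the Borel sets of the product
  agree with the product sigma-algebra and makes a measure live on its support.\<close>

lemma open_generate_topology_balls:
  fixes D :: "'a::metric_space set"
  assumes dense: "\<And>x e. e > 0 \<Longrightarrow> \<exists>y\<in>D. dist x y < e"
  shows "open = generate_topology ((\<lambda>(y, n). ball y (inverse (real (Suc n)))) ` (D \<times> UNIV))"
proof (rule topological_basis_imp_subbasis, rule topological_basisI)
  fix B assume "B \<in> (\<lambda>(y, n). ball y (inverse (real (Suc n)))) ` (D \<times> UNIV)"
  then show "open B" by auto
next
  fix U :: "'a set" and x assume U: "open U" "x \<in> U"
  then obtain e where e: "e > 0" "ball x e \<subseteq> U" by (auto simp: open_contains_ball)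
  obtain n where n: "inverse (real (Suc n)) < e / 2" using e reals_Archimedean[of "e / 2"] by auto
  obtain y where y: "y \<in> D" "dist x y < inverse (real (Suc n))"
    using dense[of "inverse (real (Suc n))" x] by auto
  have "ball y (inverse (real (Suc n))) \<subseteq> ball x e"
  proof
    fix z assume "z \<in> ball y (inverse (real (Suc n)))"
    then have "dist y z < e / 2" using n by (simp add: mem_ball)
    moreover have "dist x y < e / 2" using y n by simp
    ultimately show "z \<in> ball x e" using dist_triangle[of x z y] by simp
  qed
  then show "\<exists>B\<in>(\<lambda>(y, n). ball y (inverse (real (Suc n)))) ` (D \<times> UNIV). x \<in> B \<and> B \<subseteq> U"
    using y e by (intro bexI[of _ "ball y (inverse (real (Suc n)))"]) (auto simp: dist_commute)
qed

section \<open>The topology of the sphere\<close>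

text \<open>A chord of the unit sphere is no longer than its arc: for an arc of length
  \<open>d\<close> the chord is \<open>2 * sin (d / 2)\<close>.\<close>

lemma norm_stereo_diff_le: "norm (stereo x - stereo y) \<le> dist x y"
proof -
  define d where "d = dist x y"
  have b: "\<bar>stereo x \<bullet> stereo y\<bar> \<le> 1" by (simp add: abs_inner_unit norm_stereo)
  have "stereo x \<bullet> stereo y = cos d"
    using b by (simp add: d_def dist_csphere_def cos_arccos_abs)
  then have "(norm (stereo x - stereo y))\<^sup>2 = 2 - 2 * cos d"
    using norm_stereo[of x] norm_stereo[of y] inner_commute[of "stereo y" "stereo x"]
    by (simp add: power2_norm_eq_inner inner_diff norm_eq_1)
  also have "\<dots> = (2 * sin (d / 2))\<^sup>2"
    using cos_double_sin[of "d / 2"] by (simp add: power_mult_distrib)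
  also have "\<dots> \<le> d\<^sup>2"
    using abs_sin_x_le_abs_x[of "d / 2"] by (intro abs_le_square_iff[THEN iffD1]) auto
  finally have "norm (stereo x - stereo y) \<le> d"
    by (rule power2_le_imp_le) (simp add: d_def)
  then show ?thesis by (simp add: d_def)
qed

lemma continuous_on_stereo: "continuous_on A stereo"
proof (rule continuous_on_iff[THEN iffD2], intro ballI allI impI)
  fix x and e :: real assume "e > 0"
  then show "\<exists>d>0. \<forall>y\<in>A. dist y x < d \<longrightarrow> dist (stereo y) (stereo x) < e"
    using norm_stereo_diff_le[of _ x] by (intro exI[of _ e]) (auto simp: dist_norm intro: le_less_trans)
qed

text \<open>The inner product with the limit tends to 1 and \<open>arccos\<close> is continuous on
  [-1, 1], so the angle tends to 0. Continuity into the sphere can therefore be checked in Euclidean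
  coordinates.\<close>

lemma tendsto_csphere_stereo:
  assumes "((\<lambda>x. stereo (f x)) \<longlongrightarrow> stereo l) F"
  shows "(f \<longlongrightarrow> l) F"
proof -
  have "((\<lambda>x. stereo (f x) \<bullet> stereo l) \<longlongrightarrow> stereo l \<bullet> stereo l) F"
    by (intro tendsto_intros assms)
  then have lim: "((\<lambda>x. stereo (f x) \<bullet> stereo l) \<longlongrightarrow> 1) F"
    by (simp add: dot_square_norm norm_stereo)
  have "stereo y \<bullet> stereo l \<in> {- 1..1}" for y
    using abs_inner_unit[OF norm_stereo norm_stereo, of y l] by (simp add: abs_le_iff)
  with lim have "((\<lambda>x. arccos (stereo (f x) \<bullet> stereo l)) \<longlongrightarrow> arccos 1) F"
    by (intro continuous_on_tendsto_compose[OF continuous_on_arccos']) auto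
  then show ?thesis by (subst tendsto_dist_iff) (simp add: dist_csphere_def)
qed

lemma continuous_on_csphere_stereo:
  "continuous_on A (\<lambda>x. stereo (f x)) \<Longrightarrow> continuous_on A f"
  by (simp add: continuous_on_def tendsto_csphere_stereo)

lemma continuous_on_Fin [continuous_intros]: "continuous_on A Fin"
proof (rule continuous_on_csphere_stereo)
  have "1 + (cmod z)\<^sup>2 \<noteq> 0" "(cmod z)\<^sup>2 + 1 \<noteq> 0" for z
    using zero_le_power2[of "cmod z"] by linarith+
  then show "continuous_on A (\<lambda>z. stereo (Fin z))"
    unfolding stereo.simps by (intro continuous_intros) auto
qed

lemma compact_Fin_cball: "compact (Fin ` cball 0 c)"
  by (rule compact_continuous_image[OF continuous_on_Fin compact_cball])

lemma closed_Fin_cball: "closed (Fin ` cball 0 c)"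
  by (rule compact_imp_closed[OF compact_Fin_cball])

text \<open>A point of modulus \<open>t\<close> has height \<open>(t^2 - 1) / (t^2 + 1)\<close> on
  the sphere, whose \<open>arccos\<close> is its distance to \<open>Infty\<close>; the height tends
  to 1. With \<open>far_from_Infty\<close>, complements of discs thus form a neighbourhood base at
  \<open>Infty\<close>.\<close>

lemma near_Infty:
  assumes "e > 0"
  obtains c where "c > 0" "\<And>x. x \<notin> Fin ` ball 0 c \<Longrightarrow> dist x Infty < e"
proof -
  have "((\<lambda>t::real. (t\<^sup>2 - 1) / (t\<^sup>2 + 1)) \<longlongrightarrow> 1) at_top" by real_asymp
  moreover have "- 1 \<le> (t\<^sup>2 - 1) / (t\<^sup>2 + 1) \<and> (t\<^sup>2 - 1) / (t\<^sup>2 + 1) \<le> 1" for t :: real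
    using zero_le_power2[of t] add_nonneg_pos[OF zero_le_power2[of t] zero_less_one]
    by (simp only: pos_le_divide_eq pos_divide_le_eq) simp
  ultimately have "((\<lambda>t::real. arccos ((t\<^sup>2 - 1) / (t\<^sup>2 + 1))) \<longlongrightarrow> arccos 1) at_top"
    by (intro continuous_on_tendsto_compose[OF continuous_on_arccos']) auto
  then have "\<forall>\<^sub>F t in at_top. arccos ((t\<^sup>2 - 1) / (t\<^sup>2 + 1)) < e"
    using assms by (intro order_tendstoD(2)) auto
  then obtain c where c: "\<And>t. t \<ge> c \<Longrightarrow> arccos ((t\<^sup>2 - 1) / (t\<^sup>2 + 1)) < e"
    by (auto simp: eventually_at_top_linorder)
  show ?thesis
  proof
    show "max c 1 > 0" by simp
    fix x assume x: "x \<notin> Fin ` ball 0 (max c 1)"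
    show "dist x Infty < e"
    proof (cases x)
      case (Fin w)
      then have "cmod w \<ge> c" using x by (auto simp: not_less)
      with Fin c show ?thesis by (simp add: dist_csphere_def)
    qed (use assms in simp)
  qed
qed

lemma far_from_Infty:
  obtains e where "e > 0" "\<And>x. dist x Infty < e \<Longrightarrow> x \<notin> Fin ` cball 0 c"
proof -
  have "open (- Fin ` cball 0 c)" using closed_Fin_cball by (rule open_Compl)
  moreover have "Infty \<in> - Fin ` cball 0 c" by auto
  ultimately obtain e where "e > 0" "\<forall>x. dist x Infty < e \<longrightarrow> x \<in> - Fin ` cball 0 c"
    unfolding open_dist by blast
  with that show ?thesis by auto
qed

instance csphere :: second_countable_topology
proof
  obtain D :: "complex set" where D: "countable D" "\<And>X. open X \<Longrightarrow> X \<noteq> {} \<Longrightarrow> \<exists>d\<in>D. d \<in> X"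
    by (rule countable_dense_setE) blast
  have "\<exists>y\<in>insert Infty (Fin ` D). dist x y < e" if e: "e > 0" for x e
  proof (cases x)
    case (Fin z)
    have "open (Fin -` ball x e)" by (intro open_vimage continuous_intros) auto
    moreover have "z \<in> Fin -` ball x e" using Fin e by simp
    ultimately obtain d where "d \<in> D" "d \<in> Fin -` ball x e" using D(2) by blast
    then show ?thesis by auto
  qed (use e in auto)
  then have "open = generate_topology ((\<lambda>(y, n). ball y (inverse (real (Suc n)))) ` (insert Infty (Fin ` D) \<times> UNIV))"
    by (rule open_generate_topology_balls)
  moreover have "countable ((\<lambda>(y, n). ball y (inverse (real (Suc n)))) ` (insert Infty (Fin ` D) \<times> (UNIV :: nat set)))"
    using D(1) by (intro countable_image countable_SIGMA countable_insert) auto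
  ultimately show "\<exists>B::csphere set set. countable B \<and> open = generate_topology B"
    by blast
qed

lemma continuous_on_sphere_poly [continuous_intros]:
  assumes "degree p > 0"
  shows "continuous_on UNIV (sphere_poly p)"
proof -
  \<comment> \<open>Stereographic projection from the north pole, a left inverse of
    \<open>Fin\<close>. It is continuous off \<open>Infty\<close>, so near complex points
    \<open>sphere_poly p\<close> is a composition of continuous maps.\<close>
  define fin where "fin x = (1 / (1 - snd (stereo x))) *\<^sub>R fst (stereo x)" for x
  have pos: "(cmod z)\<^sup>2 + 1 > 0" for z by (simp add: add_nonneg_pos)
  have snd1: "1 - snd (stereo (Fin z)) = 2 / ((cmod z)\<^sup>2 + 1)" for z
    using pos[of z] by (simp add: field_simps)
  have fin: "fin (Fin z) = z" for z
  proof -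
    have "1 / (2 / ((cmod z)\<^sup>2 + 1)) * (2 / (1 + (cmod z)\<^sup>2)) = 1"
      using pos[of z] by (simp add: add.commute)
    then show ?thesis unfolding fin_def snd1 by (simp only: stereo.simps fst_conv scaleR_scaleR scaleR_one)
  qed
  have fin_open: "open (range Fin)"
  proof -
    have "range Fin = - {Infty}" by (auto, metis csphere.exhaust rangeI)
    then show ?thesis by auto
  qed
  have "continuous_on (range Fin) (\<lambda>x. Fin (poly p (fin x)))"
  proof (rule continuous_on_compose2[OF continuous_on_Fin[of UNIV]])
    have "1 - snd (stereo x) \<noteq> 0" if "x \<in> range Fin" for x
      using that pos snd1 by (metis divide_eq_0_iff imageE less_irrefl zero_neq_numeral)
    then show "continuous_on (range Fin) (\<lambda>x. poly p (fin x))"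
      unfolding fin_def by (intro continuous_intros continuous_on_stereo) auto
  qed auto
  then have "continuous_on (range Fin) (sphere_poly p)"
    by (rule continuous_on_eq) (auto simp: fin)
  then have at_Fin: "isCont (sphere_poly p) (Fin z)" for z
    using fin_open by (simp add: continuous_on_eq_continuous_at)
  \<comment> \<open>At \<open>Infty\<close> continuity means that values are large at large
    arguments, which holds because \<open>p\<close> is not constant.\<close>
  have "\<exists>d>0. \<forall>x. dist x Infty < d \<longrightarrow> dist (sphere_poly p x) Infty < e" if e: "e > 0" for e
  proof -
    obtain c where c: "c > 0" "\<And>x. x \<notin> Fin ` ball 0 c \<Longrightarrow> dist x Infty < e"
      using near_Infty[OF e] by blast
    obtain a q where p: "p = pCons a q" by (cases p)
    with assms have "q \<noteq> 0" by auto
    then obtain r where r: "\<And>z. r \<le> cmod z \<Longrightarrow> c \<le> cmod (poly p z)"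
      using poly_infinity[of q c a] p by blast
    obtain d where d: "d > 0" "\<And>x. dist x Infty < d \<Longrightarrow> x \<notin> Fin ` cball 0 r"
      using far_from_Infty[of r] by blast
    have "dist (sphere_poly p x) Infty < e" if "dist x Infty < d" for x
    proof (cases x)
      case (Fin z)
      have "cmod z \<ge> r" using d(2)[OF that] Fin by (auto simp: image_iff)
      then show ?thesis using r[of z] Fin by (intro c(2)) (auto simp: not_less)
    qed (use e in simp)
    with d(1) show ?thesis by blast
  qed
  then have "isCont (sphere_poly p) Infty"
    unfolding continuous_at_eps_delta by simp
  with at_Fin show ?thesis
    by (metis continuous_at_imp_continuous_on csphere.exhaust)
qed

text \<open>The allowed error is relative to \<open>1 + cmod a\<close> because the spherical metric
  shrinks distances far out; hence one \<open>h\<close> serves all points. This turns small changes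
  of coefficients into small changes in the supremum metric.\<close>

lemma dist_Fin_small:
  assumes "e > 0"
  obtains h where "h > 0" "\<And>a b. cmod (a - b) \<le> h * (1 + cmod a) \<Longrightarrow> dist (Fin a) (Fin b) < e"
proof -
  have pos: "\<forall>\<^sub>F t in at_right (0::real). t > 0" by (rule eventually_at_right_less)
  have lim: "((\<lambda>t::real. 1 - 4 * t\<^sup>2) \<longlongrightarrow> 1) (at_right 0)" by real_asymp
  have "\<forall>\<^sub>F t::real in at_right 0. - 1 < 1 - 4 * t\<^sup>2"
    using order_tendstoD(1)[OF lim, of "-1"] by simp
  then have ge: "\<forall>\<^sub>F t::real in at_right 0. - 1 \<le> 1 - 4 * t\<^sup>2"
    by (rule eventually_mono) simp
  from lim have "((\<lambda>t::real. arccos (1 - 4 * t\<^sup>2)) \<longlongrightarrow> arccos 1) (at_right 0)"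
    by (rule continuous_on_tendsto_compose[OF continuous_on_arccos']) (use ge in simp_all)
  then have "\<forall>\<^sub>F t in at_right 0. arccos (1 - 4 * t\<^sup>2) < e"
    using assms order_tendstoD(2)[of "\<lambda>t. arccos (1 - 4 * t\<^sup>2)"] by simp
  with pos ge have "\<forall>\<^sub>F t in at_right (0::real). t > 0 \<and> - 1 \<le> 1 - 4 * t\<^sup>2 \<and> arccos (1 - 4 * t\<^sup>2) < e"
    by eventually_elim auto
  then obtain h :: real where h: "h > 0" "- 1 \<le> 1 - 4 * h\<^sup>2" "arccos (1 - 4 * h\<^sup>2) < e"
    using eventually_happens' trivial_limit_at_right_real by blast
  show ?thesis
  proof
    fix a b assume ab: "cmod (a - b) \<le> h * (1 + cmod a)"
    define s t where "s = (cmod a)\<^sup>2" and "t = (cmod b)\<^sup>2"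
    have st: "s \<ge> 0" "t \<ge> 0" by (simp_all add: s_def t_def)
    have eq: "(cmod (a - b))\<^sup>2 = s + t - 2 * (a \<bullet> b)"
      by (simp add: s_def t_def power2_norm_eq_inner inner_diff inner_commute)
    \<comment> \<open>The chordal distance formula: the squared chord is
      \<open>4 * (cmod (a - b))^2 / ((1 + s) * (1 + t))\<close>, and the inner product is 1 minus
      half of it.\<close>
    have "stereo (Fin a) \<bullet> stereo (Fin b)
        = (2 / (1 + s)) * (2 / (1 + t)) * (a \<bullet> b) + ((s - 1) / (s + 1)) * ((t - 1) / (t + 1))"
      by (simp add: s_def t_def)
    also have "\<dots> = 1 - 2 * (s + t - 2 * (a \<bullet> b)) / ((1 + s) * (1 + t))"
      using st by (simp add: divide_simps) (simp add: algebra_simps)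
    finally have inn: "stereo (Fin a) \<bullet> stereo (Fin b) = 1 - 2 * (cmod (a - b))\<^sup>2 / ((1 + s) * (1 + t))"
      by (simp add: eq)
    have "(1 + cmod a)\<^sup>2 \<le> 2 * (1 + s)"
      using zero_le_power2[of "1 - cmod a"] by (simp add: s_def power2_eq_square algebra_simps)
    moreover have "(cmod (a - b))\<^sup>2 \<le> (h * (1 + cmod a))\<^sup>2"
      using ab by (intro power_mono) auto
    ultimately have "(cmod (a - b))\<^sup>2 \<le> h\<^sup>2 * (2 * (1 + s))"
      by (smt (verit) mult_left_mono power_mult_distrib zero_le_power2)
    also have "\<dots> \<le> h\<^sup>2 * (2 * (1 + s)) * (1 + t)"
      using st mult_left_mono[of 1 "1 + t" "h\<^sup>2 * (2 * (1 + s))"] by simp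
    finally have "2 * (cmod (a - b))\<^sup>2 \<le> 4 * h\<^sup>2 * ((1 + s) * (1 + t))"
      by (simp add: algebra_simps)
    then have "2 * (cmod (a - b))\<^sup>2 / ((1 + s) * (1 + t)) \<le> 4 * h\<^sup>2"
      using st by (subst pos_divide_le_eq) (auto intro!: mult_pos_pos)
    then have "1 - 4 * h\<^sup>2 \<le> stereo (Fin a) \<bullet> stereo (Fin b)" using inn by simp
    then have "arccos (stereo (Fin a) \<bullet> stereo (Fin b)) \<le> arccos (1 - 4 * h\<^sup>2)"
      using h(2) abs_inner_unit[OF norm_stereo norm_stereo, of "Fin a" "Fin b"]
      by (intro arccos_le_arccos) auto
    then show "dist (Fin a) (Fin b) < e" using h(3) by (simp add: dist_csphere_def)
  qed (fact h(1))
qed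

section \<open>Polynomial maps\<close>

lemma app_poly_cases:
  obtains p where "degree p \<ge> 2" "app f = sphere_poly p"
  using app[of f] by auto

lemma app_Infty [simp]: "app f Infty = Infty"
  by (rule app_poly_cases[of f]) simp

lemma dist_app_le: "dist (app f z) (app g z) \<le> dist f g"
  unfolding dist_polymap_def
  by (rule cSUP_upper[OF _ bdd_aboveI[where M = pi]]) (auto simp: dist_csphere_le_pi)

lemma dist_polymap_leI: "(\<And>z. dist (app f z) (app g z) \<le> e) \<Longrightarrow> dist f g \<le> e"
  unfolding dist_polymap_def by (rule cSUP_least) auto

lemma continuous_on_app: "continuous_on A (app f)"
proof -
  obtain p where "degree p \<ge> 2" "app f = sphere_poly p" by (rule app_poly_cases)
  then show ?thesis using continuous_on_sphere_poly[of p] continuous_on_subset by fastforce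
qed

text \<open>Changing the map costs at most its distance in the supremum metric, uniformly in the
  point; changing the point costs little by continuity of the fixed map \<open>f\<close>. Joint
  continuity is what makes random iterates measurable.\<close>

lemma continuous_on_app2: "continuous_on UNIV (\<lambda>x. app (fst x) (snd x))"
  unfolding continuous_on_def
proof
  fix x0 :: "polymap \<times> csphere"
  obtain f z where x0: "x0 = (f, z)" by (cases x0)
  have "continuous_on UNIV (\<lambda>x :: polymap \<times> csphere. dist (fst x) f + dist (app f (snd x)) (app f z))"
    by (intro continuous_intros continuous_on_compose2[OF continuous_on_app[of UNIV]]) auto
  then have "((\<lambda>x. dist (fst x) f + dist (app f (snd x)) (app f z))
      \<longlongrightarrow> dist (fst x0) f + dist (app f (snd x0)) (app f z)) (at x0 within UNIV)"
    unfolding continuous_on_def by (rule bspec) simp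
  then have "((\<lambda>x. dist (fst x) f + dist (app f (snd x)) (app f z)) \<longlongrightarrow> 0) (at x0 within UNIV)"
    by (simp only: x0 fst_conv snd_conv dist_self add_0_right)
  then have "((\<lambda>x. dist (app (fst x) (snd x)) (app f z)) \<longlongrightarrow> 0) (at x0 within UNIV)"
  proof (rule Lim_null_comparison[rotated])
    have "dist (app g w) (app f z) \<le> dist g f + dist (app f w) (app f z)" for g w
      using dist_triangle[of "app g w" "app f z" "app f w"] dist_app_le[of g w f] by linarith
    then show "\<forall>\<^sub>F x in at x0 within UNIV. norm (dist (app (fst x) (snd x)) (app f z))
        \<le> dist (fst x) f + dist (app f (snd x)) (app f z)"
      by (intro always_eventually) simp
  qed
  then show "((\<lambda>x. app (fst x) (snd x)) \<longlongrightarrow> app (fst x0) (snd x0)) (at x0 within UNIV)"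
    by (subst tendsto_dist_iff) (simp add: x0)
qed

lemma continuous_on_app_left: "continuous_on UNIV (\<lambda>f. app f z)"
proof -
  have "continuous_on UNIV (\<lambda>f. (\<lambda>x. app (fst x) (snd x)) (f, z))"
    by (rule continuous_on_compose2[OF continuous_on_app2]) (auto intro!: continuous_intros)
  then show ?thesis by simp
qed

section \<open>Growth of polynomials and a countable dense family of maps\<close>

lemma poly_bounded_below_at_infinity:
  fixes q :: "complex poly"
  assumes "q \<noteq> 0"
  obtains c r where "c > 0" "\<And>z. r \<le> cmod z \<Longrightarrow> c \<le> cmod (poly q z)"
proof (cases q rule: pCons_cases)
  case (pCons a q')
  show ?thesis
  proof (cases "q' = 0")
    case True
    then show ?thesis using assms pCons that[of "cmod a"] by auto
  next
    case False
    then show ?thesis using poly_infinity[of q' 1 a] pCons that[of 1] by fastforce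
  qed
qed

text \<open>This bounds the effect of a coefficient change by a relative error as in
  \<open>dist_Fin_small\<close>. In the induction, multiplying the bound for \<open>q\<close> by
  \<open>cmod z\<close> leaves \<open>cmod (z * poly q z)\<close>, which is within
  \<open>cmod a\<close> of the new value, and \<open>cmod z\<close> itself, which is bounded
  separately.\<close>

lemma power_le_poly:
  fixes p :: "complex poly"
  assumes "k \<le> degree p"
  shows "\<exists>C>0. \<forall>z. cmod z ^ k \<le> C * (1 + cmod (poly p z))"
  using assms
proof (induction p arbitrary: k)
  case 0
  then show ?case by (intro exI[of _ 1]) auto
next
  case (pCons a q)
  show ?case
  proof (cases k)
    case 0
    then show ?thesis by (intro exI[of _ 1]) auto
  next
    case (Suc j)
    with pCons.prems have q: "q \<noteq> 0" and j: "j \<le> degree q" by (auto split: if_splits)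
    from pCons.IH[OF j] obtain C where C: "C > 0" "\<And>z. cmod z ^ j \<le> C * (1 + cmod (poly q z))"
      by blast
    obtain c r where c: "c > 0" "\<And>z. r \<le> cmod z \<Longrightarrow> c \<le> cmod (poly q z)"
      by (rule poly_bounded_below_at_infinity[OF q]) blast
    \<comment> \<open>The term \<open>\<bar>r\<bar>\<close> covers \<open>cmod z < r\<close>; the
      other two come from dividing \<open>cmod z * c \<le> cmod (z * poly q z)\<close> by
      \<open>c\<close> when \<open>r \<le> cmod z\<close>.\<close>
    define C1 where "C1 = \<bar>r\<bar> + cmod a / c + 1 / c"
    have C1: "C1 \<ge> 0" using c(1) by (simp add: C1_def)
    have zq: "cmod (z * poly q z) \<le> cmod (poly (pCons a q) z) + cmod a" for z
      using norm_triangle_ineq4[of "poly (pCons a q) z" a] by simp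
    have z: "cmod z \<le> C1 * (1 + cmod (poly (pCons a q) z))" for z
    proof (cases "r \<le> cmod z")
      case True
      then have "cmod z * c \<le> cmod (z * poly q z)"
        using c(2) by (simp add: norm_mult mult_left_mono)
      then have "cmod z \<le> (cmod (poly (pCons a q) z) + cmod a) / c"
        using zq[of z] c(1) by (simp add: pos_le_divide_eq)
      also have "\<dots> = cmod a / c + 1 / c * cmod (poly (pCons a q) z)"
        by (simp add: add_divide_distrib)
      also have "\<dots> \<le> C1 + C1 * cmod (poly (pCons a q) z)"
        using c(1) by (intro add_mono mult_right_mono) (auto simp: C1_def)
      finally show ?thesis by (simp only: distrib_left mult_1_right)
    next
      case False
      moreover have "cmod a / c \<ge> 0" "1 / c \<ge> 0" using c(1) by auto
      ultimately have "cmod z \<le> C1" unfolding C1_def by linarith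
      also have "\<dots> \<le> C1 * (1 + cmod (poly (pCons a q) z))"
        using C1 mult_left_mono[of 1 "1 + cmod (poly (pCons a q) z)" C1] by simp
      finally show ?thesis .
    qed
    have "cmod z ^ k \<le> (C * (C1 + 1 + cmod a)) * (1 + cmod (poly (pCons a q) z))" for z
    proof -
      define P where "P = cmod (poly (pCons a q) z)"
      have P: "P \<ge> 0" by (simp add: P_def)
      have "cmod z ^ k \<le> cmod z * (C * (1 + cmod (poly q z)))"
        using C(2)[of z] by (simp add: Suc mult_left_mono)
      also have "\<dots> = C * (cmod z + cmod (z * poly q z))"
        by (simp add: norm_mult algebra_simps)
      also have "\<dots> \<le> C * (C1 * (1 + P) + (P + cmod a))"
        using C(1) z[of z] zq[of z] by (intro mult_left_mono add_mono) (auto simp: P_def)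
      also have "\<dots> \<le> C * ((C1 + 1 + cmod a) * (1 + P))"
        using C(1) P by (intro mult_left_mono) (auto simp: algebra_simps)
      finally show ?thesis by (simp add: P_def)
    qed
    moreover have "C1 + 1 + cmod a > 0" using C1 norm_ge_zero[of a] by linarith
    ultimately show ?thesis using C(1) by (intro exI[of _ "C * (C1 + 1 + cmod a)"]) simp
  qed
qed

text \<open>Maps whose coefficients lie in a countable dense set of complex numbers are dense: by
  \<open>power_le_poly\<close> a small change of coefficients at fixed degree is a small relative
  error at every point, hence spherically small uniformly.\<close>

instance polymap :: second_countable_topology
proof
  obtain D :: "complex set" where D: "countable D" "\<And>X. open X \<Longrightarrow> X \<noteq> {} \<Longrightarrow> \<exists>d\<in>D. d \<in> X"
    by (rule countable_dense_setE) blast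
  define Q where "Q = (\<lambda>xs. Abs_polymap (sphere_poly (Poly xs))) ` lists D"
  have "\<exists>g\<in>Q. dist f g < e" if e: "e > 0" for f e
  proof -
    obtain p where p: "degree p \<ge> 2" "app f = sphere_poly p" by (rule app_poly_cases)
    define n where "n = degree p"
    obtain h where h: "h > 0" "\<And>a b. cmod (a - b) \<le> h * (1 + cmod a) \<Longrightarrow> dist (Fin a) (Fin b) < e / 2"
      using dist_Fin_small[of "e / 2"] e by auto
    have "\<forall>k\<in>{..n}. \<exists>C>0. \<forall>z. cmod z ^ k \<le> C * (1 + cmod (poly p z))"
      by (auto simp: n_def intro: power_le_poly)
    then obtain C where C: "\<And>k. k \<le> n \<Longrightarrow> C k > 0"
      "\<And>k z. k \<le> n \<Longrightarrow> cmod z ^ k \<le> C k * (1 + cmod (poly p z))"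
      unfolding bchoice_iff by (metis atMost_iff)
    define S where "S = (\<Sum>k\<le>n. C k)"
    have S: "S > 0" unfolding S_def using C(1) by (intro sum_pos) auto
    have lc: "coeff p n \<noteq> 0" using p(1) by (auto simp: n_def)
    \<comment> \<open>The bound \<open>h / S\<close> keeps the summed error below
      \<open>h * (1 + cmod (poly p z))\<close>; the bound by the leading coefficient keeps the new
      one nonzero, so the degree stays \<open>n\<close>.\<close>
    define d where "d = min (h / S) (cmod (coeff p n))"
    have d: "d > 0" "d * S \<le> h" "d \<le> cmod (coeff p n)"
      using h(1) S lc by (auto simp: d_def min_def field_simps)
    have "\<exists>x\<in>D. x \<in> ball (coeff p k) d" for k using d(1) by (intro D(2)) auto
    then obtain q where q: "\<And>k. q k \<in> D" "\<And>k. cmod (coeff p k - q k) < d"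
      by (metis dist_norm mem_ball)
    define g where "g = Poly (map q [0..<Suc n])"
    have cg: "coeff g i = (if i \<le> n then q i else 0)" for i
      by (simp add: g_def nth_default_def less_Suc_eq_le del: upt_Suc)
    have qn: "q n \<noteq> 0" using q(2)[of n] d(3) by auto
    then have dg: "degree g = n"
      by (intro antisym degree_le le_degree) (auto simp: cg)
    have "cmod (poly p z - poly g z) \<le> h * (1 + cmod (poly p z))" for z
    proof -
      have "poly p z - poly g z = (\<Sum>i\<le>n. (coeff p i - q i) * z ^ i)"
        by (simp add: poly_altdef dg n_def[symmetric] cg left_diff_distrib sum_subtractf)
      also have "cmod \<dots> \<le> (\<Sum>i\<le>n. d * (C i * (1 + cmod (poly p z))))"
        using q(2) C d(1) by (intro sum_norm_le) (auto simp: norm_mult norm_power intro!: mult_mono intro: less_imp_le)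
      also have "\<dots> = d * S * (1 + cmod (poly p z))"
        by (simp add: S_def sum_distrib_left sum_distrib_right mult.assoc)
      also have "\<dots> \<le> h * (1 + cmod (poly p z))"
        using d(2) by (intro mult_right_mono) auto
      finally show ?thesis .
    qed
    then have *: "dist (sphere_poly p z) (sphere_poly g z) \<le> e / 2" for z
      using h(2) e by (cases z) (auto intro: less_imp_le)
    have "app (Abs_polymap (sphere_poly g)) = sphere_poly g"
      using p(1) dg by (intro Abs_polymap_inverse) (auto simp: n_def)
    then have "dist f (Abs_polymap (sphere_poly g)) \<le> e / 2"
      using * by (intro dist_polymap_leI) (simp add: p)
    moreover have "Abs_polymap (sphere_poly g) \<in> Q"
      unfolding Q_def g_def using q(1) by (intro imageI) auto
    ultimately show ?thesis using e by (intro bexI[of _ "Abs_polymap (sphere_poly g)"]) auto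
  qed
  then have "open = generate_topology ((\<lambda>(y, n). ball y (inverse (real (Suc n)))) ` (Q \<times> UNIV))"
    by (rule open_generate_topology_balls)
  moreover have "countable ((\<lambda>(y, n). ball y (inverse (real (Suc n)))) ` (Q \<times> (UNIV :: nat set)))"
    unfolding Q_def using D(1) by (intro countable_image countable_SIGMA countable_lists) auto
  ultimately show "\<exists>B::polymap set set. countable B \<and> open = generate_topology B"
    by blast
qed

text \<open>Comparing the factorization of \<open>p\<close> at \<open>w\<close> and at the point of the circle of radius \<open>r\<close> with the
  same argument gives a growth rate that does not depend on the coefficients of \<open>p\<close>; this is what
  makes the escape radius below uniform on compact sets.\<close>

lemma poly_growth:
  fixes p :: "complex poly"
  assumes deg: "degree p \<ge> 2" and r: "r > 0" and ge1: "\<And>z. r \<le> cmod z \<Longrightarrow> 1 \<le> cmod (poly p z)"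
    and w: "3 * r \<le> cmod w" "32 * r\<^sup>2 \<le> cmod w"
  shows "2 * cmod w \<le> cmod (poly p w)"
proof -
  \<comment> \<open>\<open>v\<close> is the point of modulus \<open>r\<close> on the ray through
    \<open>w\<close>, and \<open>t\<close> is the factor from \<open>v\<close> to
    \<open>w\<close>.\<close>
  define t where "t = cmod w / r"
  have t: "t \<ge> 3" "cmod w = t * r" using r w by (simp_all add: t_def field_simps)
  define v where "v = w / of_real t"
  have v: "cmod v = r" using t by (simp add: v_def norm_divide)
  obtain a where a: "smult (lead_coeff p) (\<Prod>i<degree p. [:- a i, 1:]) = p"
    by (rule complex_poly_decompose')
  have val: "poly p z = lead_coeff p * (\<Prod>i<degree p. z - a i)" for z
    by (subst a[symmetric]) (simp add: poly_prod)
  have root: "cmod (a i) < r" if "i < degree p" for i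
  proof -
    have "poly p (a i) = 0" using that by (subst val) auto
    with ge1[of "a i"] show ?thesis by (cases "r \<le> cmod (a i)") auto
  qed
  \<comment> \<open>All roots lie in the disc of radius \<open>r\<close>, so \<open>v\<close> is at
    most \<open>2 * r\<close> from a root while \<open>w\<close> is at least
    \<open>(t - 1) * r\<close> away.\<close>
  have factor: "(t - 1) / 2 * cmod (v - a i) \<le> cmod (w - a i)" if "i < degree p" for i
  proof -
    have "cmod (v - a i) \<le> 2 * r"
      using norm_triangle_ineq4[of v "a i"] v root[OF that] by simp
    then have "(t - 1) / 2 * cmod (v - a i) \<le> (t - 1) / 2 * (2 * r)"
      using t by (intro mult_left_mono) auto
    also have "\<dots> = t * r - r" by (simp add: field_simps)
    also have "\<dots> \<le> cmod (w - a i)"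
      using norm_triangle_ineq2[of w "a i"] t root[OF that] by simp
    finally show ?thesis .
  qed
  \<comment> \<open>The hypothesis with 32 says \<open>t \<ge> 32 * r\<close>, which is this
    inequality since \<open>cmod w = t * r\<close>. The bound \<open>t \<ge> 3\<close> makes
    \<open>(t - 1) / 2\<close> at least 1 and at least \<open>t / 4\<close>, so the exponent may be
    raised from 2 to the degree.\<close>
  have "2 * cmod w \<le> (t / 4)\<^sup>2"
    using w(2) r t by (simp add: power2_eq_square field_simps)
  also have "\<dots> \<le> ((t - 1) / 2)\<^sup>2" using t by (intro power_mono) auto
  also have "\<dots> \<le> ((t - 1) / 2) ^ degree p" using t deg by (intro power_increasing) auto
  also have "\<dots> \<le> ((t - 1) / 2) ^ degree p * cmod (poly p v)"
    using mult_left_mono[OF ge1[of v], of "((t - 1) / 2) ^ degree p"] t v by simp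
  also have "\<dots> = cmod (lead_coeff p) * (\<Prod>i<degree p. (t - 1) / 2 * cmod (v - a i))"
    unfolding val norm_mult prod_norm[symmetric] prod.distrib by simp
  also have "\<dots> \<le> cmod (lead_coeff p) * (\<Prod>i<degree p. cmod (w - a i))"
    using t factor by (intro mult_left_mono prod_mono) auto
  also have "\<dots> = cmod (poly p w)" by (simp add: val norm_mult prod_norm)
  finally show ?thesis .
qed

section \<open>A uniform escape radius for a compact set of maps\<close>

text \<open>The heights on the sphere differ by at least 3/5, and the height difference is at most
  the chord, hence at most the arc.\<close>

lemma dist_Fin_ge:
  assumes "2 \<le> cmod a" "cmod b \<le> 1"
  shows "1 / 2 \<le> dist (Fin a) (Fin b)"
proof -
  have "((cmod a)\<^sup>2 - 1) / ((cmod a)\<^sup>2 + 1) \<ge> 3 / 5"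
    using power_mono[OF assms(1), of 2] by (simp add: field_simps)
  moreover have "((cmod b)\<^sup>2 - 1) / ((cmod b)\<^sup>2 + 1) \<le> 0"
    using power_mono[OF assms(2), of 2] by (intro divide_nonpos_nonneg) auto
  ultimately have "1 / 2 \<le> \<bar>snd (stereo (Fin a) - stereo (Fin b))\<bar>"
    unfolding stereo.simps snd_diff snd_conv by linarith
  also have "\<dots> \<le> norm (stereo (Fin a) - stereo (Fin b))"
    using norm_snd_le[of "snd (stereo (Fin a) - stereo (Fin b))" "fst (stereo (Fin a) - stereo (Fin b))"]
    by (simp only: prod.collapse real_norm_def)
  finally show ?thesis using norm_stereo_diff_le order_trans by blast
qed

text \<open>Finitely many balls of radius 1/2 cover the compact set. Each centre sends far points to
  modulus at least 2, and by \<open>dist_Fin_ge\<close> a map at distance less than 1/2 from it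
  cannot send them into the unit disc.\<close>

lemma uniform_lower_bound:
  assumes "compact \<Gamma>"
  obtains r where "r > 0" "\<And>f w. f \<in> \<Gamma> \<Longrightarrow> r \<le> cmod w \<Longrightarrow> app f (Fin w) \<notin> Fin ` ball 0 1"
proof -
  obtain K where K: "finite K" "\<Gamma> \<subseteq> (\<Union>f\<in>K. ball f (1/2))"
    using assms[unfolded compact_eq_totally_bounded] by (auto simp: zero_less_divide_iff elim!: allE[of _ "1/2"])
  have "\<exists>r. \<forall>w. r \<le> cmod w \<longrightarrow> app f (Fin w) \<notin> Fin ` ball 0 2" for f
  proof -
    obtain p where p: "degree p \<ge> 2" "app f = sphere_poly p" by (rule app_poly_cases)
    obtain a q where q: "p = pCons a q" by (cases p)
    with p have "q \<noteq> 0" by auto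
    from poly_infinity[OF this, of 2 a] show ?thesis unfolding p q by (force simp: not_less)
  qed
  then obtain r where r: "\<And>f w. r f \<le> cmod w \<Longrightarrow> app f (Fin w) \<notin> Fin ` ball 0 2" by metis
  \<comment> \<open>The inserted 1 keeps the maximum positive and defined even if \<open>K\<close>
    is empty.\<close>
  define r0 where "r0 = Max (insert 1 (r ` K))"
  have r0: "r0 \<ge> 1" "\<And>f. f \<in> K \<Longrightarrow> r f \<le> r0" using K(1) by (auto simp: r0_def)
  show ?thesis
  proof
    show "r0 > 0" using r0 by simp
    fix f w assume f: "f \<in> \<Gamma>" and w: "r0 \<le> cmod w"
    then obtain g where g: "g \<in> K" "dist g f < 1 / 2" using K(2) by auto
    obtain p q where pq: "app f = sphere_poly p" "app g = sphere_poly q"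
      by (metis app_poly_cases)
    have "2 \<le> cmod (poly q w)" using r[of g w] r0(2)[OF g(1)] w pq by (force simp: not_less)
    moreover have "dist (Fin (poly q w)) (Fin (poly p w)) < 1 / 2"
      using dist_app_le[of g "Fin w" f] g pq by simp
    ultimately have "1 < cmod (poly p w)" using dist_Fin_ge[of "poly q w" "poly p w"] by (meson leI not_less)
    then show "app f (Fin w) \<notin> Fin ` ball 0 1" by (auto simp: pq)
  qed
qed

text \<open>\<open>uniform_lower_bound\<close> supplies the hypothesis of \<open>poly_growth\<close>
  with a single \<open>r\<close>, so the modulus doubles beyond a common radius. Phrasing this with
  complements of discs includes \<open>Infty\<close>.\<close>

lemma escape_radius:
  assumes "compact \<Gamma>"
  obtains R where "R > 0"
    "\<And>f x c. f \<in> \<Gamma> \<Longrightarrow> c > R \<Longrightarrow> x \<notin> Fin ` ball 0 c \<Longrightarrow> app f x \<notin> Fin ` ball 0 (2 * c)"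
proof -
  obtain r where r: "r > 0" "\<And>f w. f \<in> \<Gamma> \<Longrightarrow> r \<le> cmod w \<Longrightarrow> app f (Fin w) \<notin> Fin ` ball 0 1"
    by (rule uniform_lower_bound[OF assms]) blast
  define R where "R = max (3 * r) (32 * r\<^sup>2)"
  show ?thesis
  proof
    show "R > 0" using r(1) by (simp add: R_def)
    fix f x c assume f: "f \<in> \<Gamma>" and c: "c > R" and x: "x \<notin> Fin ` ball 0 c"
    obtain p where p: "degree p \<ge> 2" "app f = sphere_poly p" by (rule app_poly_cases)
    show "app f x \<notin> Fin ` ball 0 (2 * c)"
    proof (cases x)
      case (Fin w)
      then have w: "c \<le> cmod w" using x by (force simp: not_less)
      have "1 \<le> cmod (poly p z)" if "r \<le> cmod z" for z
        using r(2)[OF f that] p(2) by (force simp: not_less)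
      then have "2 * cmod w \<le> cmod (poly p w)"
        using c w by (intro poly_growth[OF p(1) r(1)]) (auto simp: R_def)
      then show ?thesis using w by (auto simp: p(2) Fin)
    qed auto
  qed
qed

section \<open>Supports of measures and random orbits\<close>

text \<open>A point avoiding every null set of a countable basis lies in the support, and the
  countably many null basis sets have null union.\<close>

lemma AE_in_supp:
  fixes M :: "'a::second_countable_topology measure"
  assumes "sets M = sets borel"
  shows "AE x in M. x \<in> supp M"
proof -
  obtain B :: "'a set set" where B: "countable B" "topological_basis B"
    using ex_countable_basis by blast
  define N where "N = {b \<in> B. emeasure M b = 0}"
  have "AE x in M. \<forall>b\<in>N. x \<notin> b"
  proof (subst AE_ball_countable)
    show "countable N" using B(1) by (simp add: N_def)
    have "b \<in> null_sets M" if "b \<in> N" for b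
      using that B(2) assms by (intro null_setsI) (auto simp: N_def topological_basis_open)
    then show "\<forall>b\<in>N. AE x in M. x \<notin> b" by (auto intro: AE_not_in)
  qed
  then show ?thesis
  proof (rule eventually_mono)
    fix x assume x: "\<forall>b\<in>N. x \<notin> b"
    show "x \<in> supp M"
      unfolding supp_def
    proof (intro CollectI allI impI)
      fix U assume U: "open U \<and> x \<in> U"
      then obtain b where b: "b \<in> B" "x \<in> b" "b \<subseteq> U" using B(2) by (meson topological_basisE)
      then have "emeasure M b > 0" using x by (auto simp: N_def zero_less_iff_neq_zero)
      also have "emeasure M b \<le> emeasure M U" using U b assms by (intro emeasure_mono) auto
      finally show "emeasure M U > 0" .
    qed
  qed
qed

lemma supp_subset_closed:
  assumes "sets M = sets borel" "closed A" "AE x in M. x \<in> A"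
  shows "supp M \<subseteq> A"
proof
  fix x assume x: "x \<in> supp M"
  show "x \<in> A"
  proof (rule ccontr)
    assume "x \<notin> A"
    then have "emeasure M (- A) > 0" using x assms(2) by (auto simp: supp_def open_Compl)
    moreover have "emeasure M (- A) = 0"
      using assms sets_eq_imp_space_eq[OF assms(1)]
      by (subst AE_iff_measurable[symmetric, where P = "\<lambda>x. x \<in> A"]) auto
    ultimately show False by simp
  qed
qed

lemma random_iterate_case_nat:
  "random_iterate (case_nat f \<gamma>) (Suc n) z = random_iterate \<gamma> n (app f z)"
  by (induction n) auto

text \<open>Splits the staying event at the first step, as needed for the mean value equation; time
  0 contributes \<open>z \<in> D\<close>.\<close>

lemma random_iterate_case_nat_in:
  "(\<forall>n. random_iterate (case_nat f \<gamma>) n z \<in> D) \<longleftrightarrow> z \<in> D \<and> (\<forall>n. random_iterate \<gamma> n (app f z) \<in> D)"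
proof -
  have split: "(\<forall>n. P n) \<longleftrightarrow> P 0 \<and> (\<forall>n. P (Suc n))" for P :: "nat \<Rightarrow> bool"
    by (metis not0_implies_Suc)
  show ?thesis
    by (subst split) (simp only: random_iterate_case_nat random_iterate.simps(1) id_apply)
qed

lemma continuous_on_random_iterate: "continuous_on UNIV (random_iterate \<gamma> n)"
proof (induction n)
  case (Suc n)
  then show ?case unfolding random_iterate.simps
    using continuous_on_app by (rule continuous_on_compose)
qed (simp add: id_def)

lemma random_iterate_in_semigroup:
  "(\<And>n. \<gamma> n \<in> supp \<tau>) \<Longrightarrow> random_iterate \<gamma> (Suc n) \<in> semigroup_of \<tau>"
proof (induction n)
  case 0
  then show ?case by (auto simp: semigroup_of_def intro: generated_semigroup.gen)
next
  case (Suc n)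
  then have "app (\<gamma> (Suc n)) \<circ> random_iterate \<gamma> (Suc n) \<in> semigroup_of \<tau>"
    unfolding semigroup_of_def
    by (intro generated_semigroup.comp[OF generated_semigroup.gen] imageI)
       (simp_all del: random_iterate.simps)
  then show ?case by (subst random_iterate.simps(2))
qed

lemma continuous_on_semigroup_of: "g \<in> semigroup_of \<tau> \<Longrightarrow> continuous_on UNIV g"
  unfolding semigroup_of_def
proof (induction rule: generated_semigroup.induct)
  case (gen g)
  then show ?case using continuous_on_app by auto
next
  case (comp g h)
  then show ?case using continuous_on_compose continuous_on_subset by blast
qed

section \<open>Random sequences of maps under the product measure\<close>

locale compact_polymap_measure = prob_space \<tau> for \<tau> :: "polymap measure" +
  assumes sets_borel: "sets \<tau> = sets borel"
    and compact_supp: "compact (supp \<tau>)"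
begin

sublocale seq: sequence_space \<tau>
  by unfold_locales

lemma space_eq: "space \<tau> = UNIV" "space seq.S = UNIV"
  using sets_eq_imp_space_eq[OF sets_borel] by (simp_all add: space_PiM PiE_UNIV_domain)

lemma measurable_coordinate: "(\<lambda>\<gamma>. \<gamma> n) \<in> seq.S \<rightarrow>\<^sub>M borel"
  using measurable_component_singleton[of n UNIV "\<lambda>_. \<tau>"]
  by (simp add: measurable_cong_sets[OF refl sets_borel])

lemma measurable_random_iterate [measurable]:
  "(\<lambda>\<gamma>. random_iterate \<gamma> n z) \<in> seq.S \<rightarrow>\<^sub>M borel"
proof (induction n)
  case (Suc n)
  have "(\<lambda>x. app (fst x) (snd x)) \<in> borel \<Otimes>\<^sub>M borel \<rightarrow>\<^sub>M borel"
    unfolding borel_prod by (rule borel_measurable_continuous_onI[OF continuous_on_app2])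
  from measurable_compose[OF measurable_Pair[OF measurable_coordinate Suc] this]
  show ?case by simp
qed simp

lemma AE_seq_supp: "AE \<gamma> in seq.S. \<forall>n. \<gamma> n \<in> supp \<tau>"
proof (subst AE_all_countable, intro allI)
  fix n
  show "AE \<gamma> in seq.S. \<gamma> n \<in> supp \<tau>"
    by (rule AE_PiM_component) (auto intro: prob_space_axioms AE_in_supp[OF sets_borel])
qed

lemma supp_nonempty: "supp \<tau> \<noteq> {}"
proof
  assume "supp \<tau> = {}"
  then have "AE x in \<tau>. False" using AE_in_supp[OF sets_borel] by simp
  then show False by simp
qed

text \<open>Convergence needs only the tolerances \<open>1 / (i + 1)\<close>, so the event is a
  countable combination of measurable ones.\<close>

lemma sets_escape: "{\<gamma>. (\<lambda>n. random_iterate \<gamma> n z) \<longlonglongrightarrow> Infty} \<in> sets seq.S"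
proof -
  have "{\<gamma>. (\<lambda>n. random_iterate \<gamma> n z) \<longlonglongrightarrow> Infty} =
      {\<gamma> \<in> space seq.S. \<forall>i. \<exists>N. \<forall>n\<ge>N. dist (random_iterate \<gamma> n z) Infty < inverse (real (Suc i))}"
  proof -
    have "(X \<longlonglongrightarrow> Infty) \<longleftrightarrow> (\<forall>i. \<exists>N. \<forall>n\<ge>N. dist (X n) Infty < inverse (real (Suc i)))" for X
      unfolding lim_sequentially
    proof safe
      fix e :: real assume *: "\<forall>i. \<exists>N. \<forall>n\<ge>N. dist (X n) Infty < inverse (real (Suc i))" and "e > 0"
      then obtain i where "inverse (real (Suc i)) < e" using reals_Archimedean by blast
      with * show "\<exists>N. \<forall>n\<ge>N. dist (X n) Infty < e" by (meson less_trans)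
    qed simp
    then show ?thesis by (simp add: space_eq)
  qed
  also have "\<dots> \<in> sets seq.S" by measurable
  finally show ?thesis .
qed

section \<open>The probability of staying in a closed set\<close>

text \<open>For the disc \<open>trap\<close> below this is the function \<open>u\<close> of the
  outline. Time 0 counts, so it vanishes outside \<open>D\<close>.\<close>

definition stay_prob :: "csphere set \<Rightarrow> csphere \<Rightarrow> real" where
  "stay_prob D z = measure seq.S {\<gamma>. \<forall>n. random_iterate \<gamma> n z \<in> D}"

lemma sets_stay:
  assumes "closed D"
  shows "{\<gamma>. \<forall>n. random_iterate \<gamma> n z \<in> D} \<in> sets seq.S"
proof -
  have [measurable]: "D \<in> sets borel" using assms by simp
  have "{\<gamma> \<in> space seq.S. \<forall>n. random_iterate \<gamma> n z \<in> D} \<in> sets seq.S" by measurable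
  then show ?thesis by (simp add: space_eq)
qed

lemma stay_prob_outside: "z \<notin> D \<Longrightarrow> stay_prob D z = 0"
proof -
  assume "z \<notin> D"
  then have "random_iterate \<gamma> 0 z \<notin> D" for \<gamma> by simp
  then have "{\<gamma>. \<forall>n. random_iterate \<gamma> n z \<in> D} = {}" by blast
  then show ?thesis by (simp only: stay_prob_def measure_empty)
qed

text \<open>Upper semicontinuity in terms of superlevel sets. A sequence of maps that keeps
  infinitely many \<open>x j\<close> in \<open>D\<close> also keeps their limit in \<open>D\<close>,
  by continuity and closedness.\<close>

lemma closed_stay_prob_ge:
  assumes "closed D"
  shows "closed {z. c \<le> stay_prob D z}"
  unfolding closed_sequential_limits
proof (intro allI impI, elim conjE)
  fix x l assume x: "\<forall>n. x n \<in> {z. c \<le> stay_prob D z}" and lim: "x \<longlonglongrightarrow> l"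
  define E where "E z = {\<gamma>. \<forall>n. random_iterate \<gamma> n z \<in> D}" for z
  \<comment> \<open>The sets \<open>F k\<close> decrease to the limit superior of the events
    \<open>E (x j)\<close>, and each has measure at least \<open>c\<close>, so the intersection does
    too.\<close>
  define F where "F k = (\<Union>j\<in>{k..}. E (x j))" for k :: nat
  have E: "E z \<in> sets seq.S" for z unfolding E_def by (rule sets_stay[OF assms])
  have F: "F k \<in> sets seq.S" for k unfolding F_def using E by auto
  have "decseq F" unfolding F_def decseq_def by fastforce
  then have "(\<lambda>k. measure seq.S (F k)) \<longlonglongrightarrow> measure seq.S (\<Inter>k. F k)"
    using F by (intro seq.P.finite_Lim_measure_decseq) auto
  moreover have "c \<le> measure seq.S (F k)" for k
  proof -
    have "c \<le> measure seq.S (E (x k))" using x by (simp add: stay_prob_def E_def)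
    also have "\<dots> \<le> measure seq.S (F k)"
      using F by (intro seq.P.finite_measure_mono) (auto simp: F_def)
    finally show ?thesis .
  qed
  ultimately have "c \<le> measure seq.S (\<Inter>k. F k)" by (intro LIMSEQ_le_const) auto
  also have "\<dots> \<le> measure seq.S (E l)"
  proof (rule seq.P.finite_measure_mono[OF _ E], rule subsetI)
    fix \<gamma> assume \<gamma>: "\<gamma> \<in> (\<Inter>k. F k)"
    have "random_iterate \<gamma> n l \<in> D" for n
    proof (rule ccontr)
      assume "random_iterate \<gamma> n l \<notin> D"
      moreover have "(\<lambda>k. random_iterate \<gamma> n (x k)) \<longlonglongrightarrow> random_iterate \<gamma> n l"
        using continuous_on_tendsto_compose[OF continuous_on_random_iterate lim] by simp
      ultimately have "\<forall>\<^sub>F k in sequentially. random_iterate \<gamma> n (x k) \<in> - D"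
        using assms by (intro topological_tendstoD) auto
      then obtain k where "\<And>j. j \<ge> k \<Longrightarrow> random_iterate \<gamma> n (x j) \<notin> D"
        by (auto simp: eventually_sequentially)
      moreover have "\<gamma> \<in> F k" using \<gamma> by blast
      ultimately show False by (auto simp: F_def E_def)
    qed
    then show "\<gamma> \<in> E l" by (simp add: E_def)
  qed
  finally show "l \<in> {z. c \<le> stay_prob D z}" by (simp add: stay_prob_def E_def)
qed

lemma borel_measurable_stay_prob:
  assumes "closed D"
  shows "(\<lambda>f. stay_prob D (app f z)) \<in> borel_measurable \<tau>"
proof -
  have "stay_prob D \<in> borel_measurable borel"
    unfolding borel_measurable_iff_ge using closed_stay_prob_ge[OF assms] by simp
  moreover have "(\<lambda>f. app f z) \<in> borel_measurable borel"
    by (rule borel_measurable_continuous_onI[OF continuous_on_app_left])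
  ultimately show ?thesis
    unfolding measurable_cong_sets[OF sets_borel refl] by (rule measurable_compose[rotated])
qed

text \<open>Prepending an independent map of law \<tau> to a random sequence preserves the product
  measure. Tonelli over the first map then gives the equation, because for \<open>z \<in> D\<close>
  the slice at \<open>f\<close> is the staying event of \<open>app f z\<close>.\<close>

lemma stay_prob_step:
  assumes "closed D" "z \<in> D"
  shows "stay_prob D z = (\<integral>f. stay_prob D (app f z) \<partial>\<tau>)"
proof -
  define E where "E z = {\<gamma>. \<forall>n. random_iterate \<gamma> n z \<in> D}" for z
  have E: "E z \<in> sets seq.S" for z unfolding E_def by (rule sets_stay[OF assms(1)])
  let ?c = "\<lambda>(f, \<gamma>). case_nat f \<gamma>"
  have c: "?c \<in> \<tau> \<Otimes>\<^sub>M seq.S \<rightarrow>\<^sub>M seq.S" by measurable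
  let ?A = "?c -` E z \<inter> space (\<tau> \<Otimes>\<^sub>M seq.S)"
  have "emeasure seq.S (E z) = emeasure (distr (\<tau> \<Otimes>\<^sub>M seq.S) seq.S ?c) (E z)"
    by (subst seq.PiM_iter) simp
  also have "\<dots> = emeasure (\<tau> \<Otimes>\<^sub>M seq.S) ?A" by (rule emeasure_distr[OF c E])
  also have "\<dots> = (\<integral>\<^sup>+ f. emeasure seq.S (Pair f -` ?A) \<partial>\<tau>)"
    by (intro seq.P.emeasure_pair_measure_alt measurable_sets[OF c E])
  also have "\<dots> = (\<integral>\<^sup>+ f. ennreal (stay_prob D (app f z)) \<partial>\<tau>)"
  proof (intro nn_integral_cong)
    fix f
    have "Pair f -` ?A = E (app f z)"
      unfolding space_pair_measure space_eq vimage_def E_def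
      using assms(2) by (simp add: random_iterate_case_nat_in)
    then show "emeasure seq.S (Pair f -` ?A) = ennreal (stay_prob D (app f z))"
      by (simp add: seq.P.emeasure_eq_measure stay_prob_def E_def)
  qed
  also have "\<dots> = ennreal (\<integral>f. stay_prob D (app f z) \<partial>\<tau>)"
    using borel_measurable_stay_prob[OF assms(1)]
    by (intro nn_integral_eq_integral integrable_const_bound[where B = 1])
       (auto simp: stay_prob_def seq.P.prob_le_1)
  finally show ?thesis
    by (simp add: seq.P.emeasure_eq_measure stay_prob_def E_def integral_nonneg)
qed

text \<open>A maximum principle: the staying probability is upper semicontinuous, hence attains its maximum
  \<open>M\<close> on \<open>D\<close>. It equals its mean over the images under \<open>\<tau>\<close>, so it is \<open>M\<close> at almost every image,
  and by semicontinuity at every image under the support.\<close>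

lemma stay_prob_pos_imp_orbit:
  assumes D: "compact D" and pos: "stay_prob D z > 0"
  obtains x where "x \<in> D" "\<And>g. g \<in> semigroup_of \<tau> \<Longrightarrow> g x \<in> D"
proof -
  have cD: "closed D" using D by (rule compact_imp_closed)
  define M where "M = (SUP x\<in>D. stay_prob D x)"
  have le1: "stay_prob D x \<le> 1" for x by (simp add: stay_prob_def seq.P.prob_le_1)
  then have bdd: "bdd_above (stay_prob D ` D)" by (intro bdd_aboveI2)
  have zD: "z \<in> D" using pos stay_prob_outside by fastforce
  then have "stay_prob D z \<le> M" unfolding M_def by (intro cSUP_upper bdd)
  with pos have M: "M > 0" by simp
  \<comment> \<open>Off \<open>D\<close> the value is 0, below the positive \<open>M\<close>, so the
    supremum over \<open>D\<close> bounds the function on the whole sphere, including at images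
    outside \<open>D\<close>.\<close>
  have leM: "stay_prob D x \<le> M" for x
    using M stay_prob_outside[of x D] by (cases "x \<in> D") (auto simp: M_def intro: cSUP_upper[OF _ bdd])
  have "\<exists>x\<in>D. M - inverse (real (Suc k)) < stay_prob D x" for k
  proof (rule less_cSUP_iff[THEN iffD1, OF _ bdd])
    show "M - inverse (real (Suc k)) < (SUP x\<in>D. stay_prob D x)"
      unfolding M_def[symmetric] by simp
  qed (use zD in blast)
  then obtain x where x: "\<And>k. x k \<in> D" "\<And>k. M - inverse (real (Suc k)) < stay_prob D (x k)"
    by metis
  obtain l r where l: "l \<in> D" "strict_mono r" "(x \<circ> r) \<longlonglongrightarrow> l"
    using D x(1) unfolding compact_eq_seq_compact_metric seq_compact_def by blast
  \<comment> \<open>Along the convergent subsequence the values eventually exceed \<open>c\<close>,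
    and the superlevel set at \<open>c\<close> is closed.\<close>
  have "c \<le> stay_prob D l" if "c < M" for c
  proof -
    have "(\<lambda>k. M - inverse (real (Suc (r k)))) \<longlonglongrightarrow> M - 0"
      by (intro tendsto_intros LIMSEQ_subseq_LIMSEQ[OF LIMSEQ_inverse_real_of_nat l(2), unfolded o_def])
    then have "\<forall>\<^sub>F k in sequentially. c < M - inverse (real (Suc (r k)))"
      using that by (intro order_tendstoD) auto
    then have "\<forall>\<^sub>F k in sequentially. (x \<circ> r) k \<in> {z. c \<le> stay_prob D z}"
      by (rule eventually_mono) (use x(2) in \<open>auto intro: less_imp_le less_trans\<close>)
    then have "l \<in> {z. c \<le> stay_prob D z}"
      by (intro Lim_in_closed_set[OF closed_stay_prob_ge[OF cD] _ _ l(3)]) auto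
    then show ?thesis by simp
  qed
  then have "M \<le> stay_prob D l" by (rule dense_le)
  then have lM: "stay_prob D l = M" using leM[of l] by simp
  have step: "stay_prob D (app f y) = M" if y: "stay_prob D y = M" and f: "f \<in> supp \<tau>" for f y
  proof -
    have "y \<in> D" using y M stay_prob_outside by fastforce
    have int: "integrable \<tau> (\<lambda>f. stay_prob D (app f y))"
      using borel_measurable_stay_prob[OF cD] le1
      by (intro integrable_const_bound[where B = 1]) (auto simp: stay_prob_def)
    then have "(\<integral>f. M - stay_prob D (app f y) \<partial>\<tau>) = 0"
      using y stay_prob_step[OF cD \<open>y \<in> D\<close>] by (simp add: prob_space)
    then have "AE f in \<tau>. M - stay_prob D (app f y) = 0"
      using int leM by (subst (asm) integral_nonneg_eq_0_iff_AE) auto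
    then have "AE f in \<tau>. f \<in> (\<lambda>f. app f y) -` {x. M \<le> stay_prob D x}"
      by (rule eventually_mono) auto
    moreover have "closed ((\<lambda>f. app f y) -` {x. M \<le> stay_prob D x})"
      by (intro closed_vimage closed_stay_prob_ge cD continuous_on_app_left)
    ultimately have "supp \<tau> \<subseteq> (\<lambda>f. app f y) -` {x. M \<le> stay_prob D x}"
      by (intro supp_subset_closed sets_borel)
    then show ?thesis using f leM[of "app f y"] by auto
  qed
  have "\<forall>y. stay_prob D y = M \<longrightarrow> stay_prob D (g y) = M" if "g \<in> semigroup_of \<tau>" for g
    using that unfolding semigroup_of_def
    by (induction rule: generated_semigroup.induct) (auto simp: step)
  \<comment> \<open>The value at \<open>g l\<close> is \<open>M > 0\<close>, which is impossible
    outside \<open>D\<close>.\<close>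
  then have "g l \<in> D" if "g \<in> semigroup_of \<tau>" for g
    using that lM M stay_prob_outside[of "g l" D] by fastforce
  with l(1) that show ?thesis by blast
qed

section \<open>Escape to infinity\<close>

text \<open>Beyond the escape radius every map in the support at least doubles the modulus, so the
  orbit grows geometrically whatever the choice of maps.\<close>

lemma escapes_outside_disc:
  obtains R where
    "\<And>\<gamma> x. (\<And>n. \<gamma> n \<in> supp \<tau>) \<Longrightarrow> x \<notin> Fin ` cball 0 R \<Longrightarrow> (\<lambda>n. random_iterate \<gamma> n x) \<longlonglongrightarrow> Infty"
proof -
  obtain R where R: "R > 0"
    "\<And>f x c. f \<in> supp \<tau> \<Longrightarrow> c > R \<Longrightarrow> x \<notin> Fin ` ball 0 c \<Longrightarrow> app f x \<notin> Fin ` ball 0 (2 * c)"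
    by (rule escape_radius[OF compact_supp]) blast
  have "(\<lambda>n. random_iterate \<gamma> n x) \<longlonglongrightarrow> Infty"
    if \<gamma>: "\<And>n. \<gamma> n \<in> supp \<tau>" and x: "x \<notin> Fin ` cball 0 R" for \<gamma> x
  proof -
    \<comment> \<open>\<open>escape_radius\<close> needs \<open>c\<close> strictly above
      \<open>R\<close>; removing the closed disc leaves room for it.\<close>
    have "\<exists>c>R. x \<notin> Fin ` ball 0 c"
    proof (cases x)
      case (Fin w)
      then show ?thesis using x by (intro exI[of _ "cmod w"]) (auto simp: image_iff)
    next
      case Infty
      then show ?thesis by (intro exI[of _ "R + 1"]) auto
    qed
    then obtain c where c: "c > R" "x \<notin> Fin ` ball 0 c" by blast
    have grow: "random_iterate \<gamma> n x \<notin> Fin ` ball 0 (2 ^ n * c)" for n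
    proof (induction n)
      case 0
      then show ?case using c by simp
    next
      case (Suc n)
      have "1 * c \<le> 2 ^ n * c" using c(1) R(1) by (intro mult_right_mono one_le_power) auto
      then have "R < 2 ^ n * c" using c(1) by linarith
      from R(2)[OF \<gamma> this Suc] show ?case by (simp add: mult.assoc)
    qed
    show ?thesis
      unfolding lim_sequentially
    proof (intro allI impI)
      fix e :: real assume "e > 0"
      then obtain b where b: "b > 0" "\<And>x. x \<notin> Fin ` ball 0 b \<Longrightarrow> dist x Infty < e"
        by (rule near_Infty) blast
      obtain N where N: "b / c < 2 ^ N" using real_arch_pow[of 2 "b / c"] by auto
      have "dist (random_iterate \<gamma> n x) Infty < e" if "n \<ge> N" for n
      proof (rule b(2))
        have "b < 2 ^ N * c" using N c(1) R(1) by (simp add: pos_divide_less_eq)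
        also have "\<dots> \<le> 2 ^ n * c" using that c(1) R(1) by (intro mult_right_mono power_increasing) auto
        finally have "ball 0 b \<subseteq> ball (0::complex) (2 ^ n * c)" by (intro subset_ball) simp
        with grow[of n] show "random_iterate \<gamma> n x \<notin> Fin ` ball 0 b" by blast
      qed
      then show "\<exists>N. \<forall>n\<ge>N. dist (random_iterate \<gamma> n x) Infty < e" by blast
    qed
  qed
  with that show ?thesis by blast
qed

section \<open>The trapping disc and the escape probability\<close>

text \<open>One radius from \<open>escapes_outside_disc\<close> is fixed so that all later arguments
  refer to the same disc.\<close>

definition trap_radius :: real where
  "trap_radius = (SOME R. \<forall>\<gamma> x. (\<forall>n. \<gamma> n \<in> supp \<tau>) \<longrightarrow> x \<notin> Fin ` cball 0 R \<longrightarrow>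
     (\<lambda>n. random_iterate \<gamma> n x) \<longlonglongrightarrow> Infty)"

abbreviation trap :: "csphere set" where "trap \<equiv> Fin ` cball 0 trap_radius"

lemma tendsto_Infty_outside_trap:
  assumes "\<And>n. \<gamma> n \<in> supp \<tau>" "x \<notin> trap"
  shows "(\<lambda>n. random_iterate \<gamma> n x) \<longlonglongrightarrow> Infty"
proof -
  have "\<exists>R. \<forall>\<gamma> x. (\<forall>n. \<gamma> n \<in> supp \<tau>) \<longrightarrow> x \<notin> Fin ` cball 0 R \<longrightarrow>
     (\<lambda>n. random_iterate \<gamma> n x) \<longlonglongrightarrow> Infty"
    by (rule escapes_outside_disc) blast
  from someI_ex[OF this] assms show ?thesis unfolding trap_radius_def by blast
qed

lemma random_iterate_add:
  "random_iterate \<gamma> (n + k) x = random_iterate (\<lambda>i. \<gamma> (i + k)) n (random_iterate \<gamma> k x)"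
  by (induction n) auto

text \<open>Almost every orbit leaves the trap at some time \<open>k\<close>; from there the shifted
  sequence, still in the support, carries it to \<open>Infty\<close>.\<close>

lemma T_inf_eq_1:
  assumes "stay_prob trap z = 0"
  shows "T_inf \<tau> z = 1"
proof -
  have "AE \<gamma> in seq.S. \<gamma> \<notin> {\<gamma>. \<forall>n. random_iterate \<gamma> n z \<in> trap}"
    using assms sets_stay[OF closed_Fin_cball]
    by (intro AE_not_in null_setsI) (auto simp: stay_prob_def seq.P.emeasure_eq_measure)
  with AE_seq_supp have "AE \<gamma> in seq.S. \<gamma> \<in> {\<gamma>. (\<lambda>n. random_iterate \<gamma> n z) \<longlonglongrightarrow> Infty}"
  proof eventually_elim
    case (elim \<gamma>)
    then obtain k where "random_iterate \<gamma> k z \<notin> trap" by auto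
    with elim(1) have "(\<lambda>n. random_iterate \<gamma> (n + k) z) \<longlonglongrightarrow> Infty"
      unfolding random_iterate_add by (intro tendsto_Infty_outside_trap) auto
    then have "(\<lambda>n. random_iterate \<gamma> n z) \<longlonglongrightarrow> Infty" by (rule LIMSEQ_offset)
    then show ?case by simp
  qed
  then show ?thesis
    unfolding T_inf_def using sets_escape by (subst seq.P.prob_eq_1) auto
qed

text \<open>Almost surely all iterates from time 1 on are semigroup elements, so the orbit stays in
  a closed set that misses \<open>Infty\<close>.\<close>

lemma T_inf_eq_0:
  assumes "x \<in> trap" "\<And>g. g \<in> semigroup_of \<tau> \<Longrightarrow> g x \<in> trap"
  shows "T_inf \<tau> x = 0"
proof -
  have "AE \<gamma> in seq.S. \<gamma> \<notin> {\<gamma>. (\<lambda>n. random_iterate \<gamma> n x) \<longlonglongrightarrow> Infty}"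
    using AE_seq_supp
  proof eventually_elim
    case (elim \<gamma>)
    have "random_iterate \<gamma> n x \<in> trap" for n
    proof (cases n)
      case (Suc m)
      have "random_iterate \<gamma> (Suc m) \<in> semigroup_of \<tau>"
        using elim by (intro random_iterate_in_semigroup) blast
      then show ?thesis unfolding Suc by (rule assms(2))
    qed (use assms(1) in simp)
    then have "Infty \<in> trap" if "(\<lambda>n. random_iterate \<gamma> n x) \<longlonglongrightarrow> Infty"
      using that by (intro Lim_in_closed_set[OF closed_Fin_cball always_eventually]) auto
    then show ?case by blast
  qed
  then show ?thesis
    unfolding T_inf_def using sets_escape by (subst seq.P.prob_eq_0) auto
qed

text \<open>After \<open>g\<close> has left the trap, iterating a single map of the support
  approaches \<open>Infty\<close>, and these iterates composed with \<open>g\<close> lie in the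
  semigroup. Allowing \<open>id\<close> handles a starting point already outside.\<close>

lemma escape_semigroup:
  assumes "g \<in> insert id (semigroup_of \<tau>)" "g x \<notin> trap" "e > 0"
  obtains h where "h \<in> semigroup_of \<tau>" "dist (h x) Infty < e"
proof -
  obtain f where f: "f \<in> supp \<tau>" using supp_nonempty by blast
  have "(\<lambda>n. random_iterate (\<lambda>_. f) n (g x)) \<longlonglongrightarrow> Infty"
    using f assms(2) by (intro tendsto_Infty_outside_trap)
  \<comment> \<open>The iterate at time 0 is \<open>id\<close>, which need not lie in the semigroup,
    so times start at 1.\<close>
  then have "(\<lambda>n. random_iterate (\<lambda>_. f) (Suc n) (g x)) \<longlonglongrightarrow> Infty"
    by (rule LIMSEQ_Suc)
  from tendstoD[OF this assms(3)]
  obtain n where n: "dist (random_iterate (\<lambda>_. f) (Suc n) (g x)) Infty < e"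
    unfolding eventually_sequentially by blast
  have "random_iterate (\<lambda>_. f) (Suc n) \<in> semigroup_of \<tau>"
    using f by (intro random_iterate_in_semigroup)
  then have "random_iterate (\<lambda>_. f) (Suc n) \<circ> g \<in> semigroup_of \<tau>"
    using assms(1) unfolding semigroup_of_def
    by (auto simp del: random_iterate.simps intro: generated_semigroup.comp)
  with that n show ?thesis by (metis comp_apply)
qed

section \<open>The set of trapped points and its frontier\<close>

text \<open>Including \<open>id\<close> puts the point itself in the disc, which makes the set
  bounded.\<close>

definition trapped :: "complex set" where
  "trapped = {w. \<forall>g\<in>insert id (semigroup_of \<tau>). g (Fin w) \<in> trap}"

lemma closed_trapped: "closed trapped"
proof -
  have "trapped = (\<Inter>g\<in>insert id (semigroup_of \<tau>). (\<lambda>w. g (Fin w)) -` trap)"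
    by (auto simp: trapped_def)
  moreover have "closed ((\<lambda>w. g (Fin w)) -` trap)" if "g \<in> insert id (semigroup_of \<tau>)" for g
  proof (intro closed_vimage closed_Fin_cball)
    have "continuous_on UNIV g"
      using that continuous_on_semigroup_of by (auto simp: id_def)
    then show "continuous_on UNIV (\<lambda>w. g (Fin w))"
      by (rule continuous_on_compose2) (auto intro: continuous_on_Fin)
  qed
  ultimately show ?thesis by (simp only:) (intro closed_INT ballI)
qed

text \<open>An orbit that leaves the trap once has semigroup images arbitrarily near
  \<open>Infty\<close>, so it is unbounded; conversely the trap is itself a bound.\<close>

lemma Khat_eq_trapped: "Khat (semigroup_of \<tau>) = trapped"
proof (intro subset_antisym subsetI)
  fix w assume "w \<in> Khat (semigroup_of \<tau>)"
  then obtain B where B: "bounded B" "(\<lambda>g. g (Fin w)) ` semigroup_of \<tau> \<subseteq> Fin ` B"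
    by (auto simp: Khat_def)
  then obtain c where c: "B \<subseteq> cball 0 c" by (auto simp: bounded_iff subset_iff)
  obtain e where e: "e > 0" "\<And>x. dist x Infty < e \<Longrightarrow> x \<notin> Fin ` cball 0 c"
    by (rule far_from_Infty) blast
  have "g (Fin w) \<in> trap" if g: "g \<in> insert id (semigroup_of \<tau>)" for g
  proof (rule ccontr)
    assume "g (Fin w) \<notin> trap"
    then obtain h where "h \<in> semigroup_of \<tau>" "dist (h (Fin w)) Infty < e"
      by (rule escape_semigroup[OF g _ e(1)])
    with e(2) B(2) c show False by blast
  qed
  then show "w \<in> trapped" unfolding trapped_def by blast
next
  fix w assume "w \<in> trapped"
  then show "w \<in> Khat (semigroup_of \<tau>)"
    unfolding Khat_def trapped_def by (intro CollectI exI[of _ "cball 0 trap_radius"]) auto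
qed

text \<open>Arbitrarily close to a frontier point there are points that some semigroup element sends near
  infinity, while the orbit of the point itself stays in the trap.\<close>

lemma frontier_trapped_subset_Julia:
  assumes "w \<in> frontier trapped"
  shows "Fin w \<in> Julia (semigroup_of \<tau>)"
proof -
  have "w \<in> trapped" using assms closed_trapped frontier_subset_closed by blast
  have "w \<in> closure (- trapped)" using assms by (simp add: frontier_closures)
  obtain e where e: "e > 0" "\<And>x. dist x Infty < e \<Longrightarrow> x \<notin> trap"
    by (rule far_from_Infty) blast
  show ?thesis
    unfolding Julia_def Fatou_def
  proof (rule ComplI, clarify)
    fix U assume U: "open U" "Fin w \<in> U" "equicontinuous_on U (semigroup_of \<tau>)"
    from U(3)[unfolded equicontinuous_on_def, rule_format, OF U(2), of "e / 2"] e(1)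
    obtain d where d: "d > 0"
      "\<And>y g. y \<in> U \<Longrightarrow> dist (Fin w) y < d \<Longrightarrow> g \<in> semigroup_of \<tau> \<Longrightarrow> dist (g (Fin w)) (g y) < e / 2"
      by auto
    have "open (Fin -` (U \<inter> ball (Fin w) d))"
      using U(1) by (intro open_vimage continuous_on_Fin) auto
    moreover have "w \<in> Fin -` (U \<inter> ball (Fin w) d)" using U(2) d(1) by simp
    ultimately have "Fin -` (U \<inter> ball (Fin w) d) \<inter> - trapped \<noteq> {}"
      using \<open>w \<in> closure (- trapped)\<close> open_Int_closure_eq_empty by blast
    then obtain v where v: "Fin v \<in> U" "dist (Fin w) (Fin v) < d" "v \<notin> trapped" by auto
    then obtain g where g: "g \<in> insert id (semigroup_of \<tau>)" "g (Fin v) \<notin> trap"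
      unfolding trapped_def by blast
    obtain h where h: "h \<in> semigroup_of \<tau>" "dist (h (Fin v)) Infty < e / 2"
      by (rule escape_semigroup[OF g, of "e / 2"]) (use e(1) in auto)
    \<comment> \<open>Equicontinuity drags \<open>h (Fin w)\<close> along with
      \<open>h (Fin v)\<close> towards \<open>Infty\<close>, although every image of a trapped point
      is farther than \<open>e\<close> from \<open>Infty\<close> or at that distance.\<close>
    have "dist (h (Fin w)) Infty < e"
      using dist_triangle[of "h (Fin w)" Infty "h (Fin v)"] d(2)[OF v(1,2) h(1)] h(2) by linarith
    then show False using e(2) \<open>w \<in> trapped\<close> h(1) by (auto simp: trapped_def)
  qed
qed

text \<open>By connectedness of the plane only the empty set and the whole plane have empty
  frontier, and a bounded set is not the plane.\<close>

lemma frontier_trapped_nonempty: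
  assumes "trapped \<noteq> {}"
  shows "frontier trapped \<noteq> {}"
proof -
  have "trapped \<subseteq> cball 0 trap_radius" by (auto simp: trapped_def)
  then have "bounded trapped" using bounded_subset bounded_cball by blast
  then have "trapped \<noteq> UNIV" using not_bounded_UNIV by auto
  with assms show ?thesis by (simp add: frontier_eq_empty)
qed

end

theorem lemma3p30:
  fixes \<tau> :: "polymap measure"
  assumes "\<tau> \<in> M1c"
  shows "((\<forall>z. T_inf \<tau> z = 1) \<longleftrightarrow> (\<forall>z\<in>Julia (semigroup_of \<tau>). T_inf \<tau> z = 1)) \<and>
    ((\<forall>z\<in>Julia (semigroup_of \<tau>). T_inf \<tau> z = 1) \<longleftrightarrow> Khat (semigroup_of \<tau>) = {})"
proof -
  interpret compact_polymap_measure \<tau>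
    using assms by (simp add: M1c_def compact_polymap_measure_def compact_polymap_measure_axioms_def)
  \<comment> \<open>(2) implies (3): a frontier point of a nonempty trapped set lies in the Julia
    set and escapes with probability 0.\<close>
  have "Khat (semigroup_of \<tau>) = {}" if J: "\<forall>z\<in>Julia (semigroup_of \<tau>). T_inf \<tau> z = 1"
  proof (rule ccontr)
    assume "Khat (semigroup_of \<tau>) \<noteq> {}"
    then obtain w where w: "w \<in> frontier trapped"
      using frontier_trapped_nonempty by (auto simp: Khat_eq_trapped)
    then have "w \<in> trapped" using closed_trapped frontier_subset_closed by blast
    then have "T_inf \<tau> (Fin w) = 0" by (intro T_inf_eq_0) (auto simp: trapped_def)
    with J frontier_trapped_subset_Julia[OF w] show False by simp
  qed
  \<comment> \<open>(3) implies (1): a positive staying probability would, by the maximum principle,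
    produce a trapped point. The remaining implication, (1) to (2), is restriction.\<close>
  moreover have "T_inf \<tau> z = 1" if K: "Khat (semigroup_of \<tau>) = {}" for z
  proof (rule T_inf_eq_1, rule ccontr)
    assume "stay_prob trap z \<noteq> 0"
    then have "stay_prob trap z > 0" by (simp add: stay_prob_def zero_less_measure_iff)
    then obtain x where x: "x \<in> trap" "\<And>g. g \<in> semigroup_of \<tau> \<Longrightarrow> g x \<in> trap"
      using stay_prob_pos_imp_orbit[OF compact_Fin_cball] by blast
    then obtain w where "x = Fin w" by blast
    with x have "w \<in> trapped" by (simp add: trapped_def)
    with K show False by (simp add: Khat_eq_trapped)
  qed
  ultimately show ?thesis by blast
qed

end
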